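(* Let $N$ be a positive integer and suppose that $f(z) = \prod_{\delta \mid N}\eta(\delta z)^{r_\delta}$ (with $r_\delta\in\mathbb{Z}$) lies in $M_k(\Gamma_0(N))$. Then $$\sum_{\delta \mid N}|r_\delta| \leq 2k\prod_{p \mid N}\left(\frac{p+1}{p-1}\right)^{\min\{2,\operatorname{ord}_p(N)\}},$$ where the product is over the primes $p$ dividing $N$.
   Context: $\eta(z) = q^{1/24}\prod_{n\ge 1}(1-q^n)$, $q = e^{2\pi i z}$, for $z$ in the upper half plane. $M_k(\Gamma_0(N))$ is the space of holomorphic modular forms of weight $k$ (trivial character) for $\Gamma_0(N)$, holomorphic at all cusps. $\operatorname{ord}_p(N)$ is the exponent of the highest power of $p$ dividing $N$. An empty product equals $1$. *)

theory Defs
  imports "HOL-Complex_Analysis.Complex_Analysis"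
begin

definition upper_half_plane :: "complex set" where
  "upper_half_plane = {z. Im z > 0}"

text \<open>The factor \<open>q\<^sup>1\<^sup>/\<^sup>2\<^sup>4\<close> means \<open>exp (2\<pi>iz/24)\<close>, not the principal
  24th root of \<open>q\<close>.  The infinite product converges for \<open>Im z > 0\<close>; values elsewhere are irrelevant.\<close>

definition dedekind_eta :: "complex \<Rightarrow> complex" where
  "dedekind_eta z =
     exp (2 * of_real pi * \<i> * z / 24) *
     (\<Prod>n. 1 - exp (2 * of_real pi * \<i> * z) ^ Suc n)"

definition eta_quotient :: "nat \<Rightarrow> (nat \<Rightarrow> int) \<Rightarrow> complex \<Rightarrow> complex" where
  "eta_quotient N r z = (\<Prod>\<delta> | \<delta> dvd N. dedekind_eta (of_nat \<delta> * z) powi r \<delta>)"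

definition SL2Z :: "(int ^ 2 ^ 2) set" where
  "SL2Z = {A. det A = 1}"

definition Gamma0 :: "nat \<Rightarrow> (int ^ 2 ^ 2) set" where
  "Gamma0 N = {A \<in> SL2Z. int N dvd A $ 2 $ 1}"

definition aut_factor :: "int ^ 2 ^ 2 \<Rightarrow> complex \<Rightarrow> complex" where
  "aut_factor A z = of_int (A $ 2 $ 1) * z + of_int (A $ 2 $ 2)"

definition moebius :: "int ^ 2 ^ 2 \<Rightarrow> complex \<Rightarrow> complex" where
  "moebius A z = (of_int (A $ 1 $ 1) * z + of_int (A $ 1 $ 2)) / aut_factor A z"

definition slash :: "int \<Rightarrow> (complex \<Rightarrow> complex) \<Rightarrow> int ^ 2 ^ 2 \<Rightarrow> complex \<Rightarrow> complex" where
  "slash k f A z = aut_factor A z powi (-k) * f (moebius A z)"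

text \<open>Holomorphy at \<open>i\<infinity>\<close>: \<open>f\<close> is a holomorphic function of \<open>exp (2\<pi>iz/h)\<close>, including
  at the origin, where \<open>h\<close> is some period of \<open>f\<close>.  Equivalently, \<open>f\<close> has a Fourier expansion
  in \<open>exp (2\<pi>iz/h)\<close> without negative exponents.\<close>

definition holomorphic_at_infinity :: "(complex \<Rightarrow> complex) \<Rightarrow> bool" where
  "holomorphic_at_infinity f \<longleftrightarrow>
     (\<exists>h::nat. h > 0 \<and> (\<exists>g. g holomorphic_on ball 0 1 \<and>
        (\<forall>z\<in>upper_half_plane. f z = g (exp (2 * of_real pi * \<i> * z / of_nat h)))))"

text \<open>Every cusp is \<open>A\<infinity>\<close> for some \<open>A \<in> SL\<^sub>2(\<int>)\<close>, so holomorphy at all cusps is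
  holomorphy at \<open>i\<infinity>\<close> of all \<open>f|\<^sub>kA\<close>.  Elements are functions on \<open>\<complex>\<close>
  of which only the restriction to the upper half plane matters.\<close>

definition modular_forms :: "int \<Rightarrow> nat \<Rightarrow> (complex \<Rightarrow> complex) set" where
  "modular_forms k N = {f.
     f holomorphic_on upper_half_plane \<and>
     (\<forall>A\<in>Gamma0 N. \<forall>z\<in>upper_half_plane. slash k f A z = f z) \<and>
     (\<forall>A\<in>SL2Z. holomorphic_at_infinity (slash k f A))}"

end

theory Submission
  imports Defs "HOL-Real_Asymp.Real_Asymp"
begin

text \<open>
  Let \<open>f\<close> be the eta quotient.  Two facts about its behaviour at the cusps determine the inequality.

  First, holomorphy at the cusp \<open>1 / c\<close> means that the order of vanishing there is nonnegative.  Up to a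
  positive factor this order is \<open>v c = (\<Sum>\<delta> | \<delta> dvd N. gcd(c, \<delta>)\<^sup>2 / \<delta> * r \<delta>)\<close>; see
  \<open>eta_quotient_order_at_cusp_nonneg\<close>.  Second, each eta function has weight \<open>1/2\<close>, so the sum
  of all \<open>r \<delta>\<close> is \<open>2k\<close>; see \<open>eta_quotient_weight\<close>.

  The rest is linear algebra.  The matrix \<open>gcd(c, \<delta>)\<^sup>2 / \<delta>\<close> is a tensor product over the primes
  dividing \<open>N\<close>, and its factors have explicit tridiagonal inverses.  Hence \<open>r\<close> is the combination
  of the columns of the inverse with the nonnegative weights \<open>v c\<close>.  In the factor at \<open>p\<close>, the sum of the
  absolute values of the entries of a column is at most \<open>((p + 1) / (p - 1))\<^bsup>min(2, ord N)\<^esup>\<close>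
  times the sum of its entries, where \<open>ord N\<close> is the exponent of \<open>p\<close> in \<open>N\<close>.  Summing over the
  columns turns this into \<open>\<Sum>\<bar>r \<delta>\<bar> \<le> (\<Prod>\<dots>) * \<Sum>r \<delta>\<close>, the content of
  \<open>l1_norm_le_of_gcd_sums_nonneg\<close>.

  The two analytic facts concern only absolute values of eta near rational points, and they need less
  than the transformation law of eta.  Taking logarithms of the product for eta leads to the Lambert series
  \<open>L(q) = \<Sum>q\<^bsup>m\<^esup> / (m (1 - q\<^bsup>m\<^esup>))\<close>, from which \<open>ln \<bar>\<eta>\<bar>\<close> is read off.  As \<open>q\<close> tends to
  a root of unity, dominated convergence gives the leading term of \<open>L(q)\<close>, hence the order at each cusp.
  The weight is the coefficient of the next, logarithmic term as \<open>q\<close> tends to \<open>1\<close>; it is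
  isolated by the combination \<open>L(q) - 2 L(q\<^sup>2)\<close>, in which the leading terms cancel.
\<close>

section \<open>Inverting the quadratic gcd form\<close>

text \<open>For fixed \<open>p\<close>, the matrix \<open>p\<^bsup>2 min(i,j)\<^esup>\<close> is the covariance matrix of a random walk
with independent increments, so its inverse is tridiagonal.  Scaling the rows by \<open>p\<^bsup>j\<^esup>\<close> gives this
inverse of \<open>gcd(p\<^bsup>i\<^esup>, p\<^bsup>j\<^esup>)\<^sup>2 / p\<^bsup>j\<^esup>\<close>, where \<open>i, j \<le> e\<close>; the two boundary columns have a smaller
diagonal entry than the others.\<close>
definition gcd_inv :: "real \<Rightarrow> nat \<Rightarrow> nat \<Rightarrow> nat \<Rightarrow> real" where
  "gcd_inv p e j i =
     (if j = i then (if i = 0 then p^2 - 1 else p^2) + (if i < e then 1 else 0)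
      else if j = Suc i \<or> i = Suc j then - p else 0) / (p ^ i * (p^2 - 1))"

lemma sum_tridiagonal:
  fixes d u l :: "nat \<Rightarrow> 'a :: comm_monoid_add"
  assumes "j \<le> e"
  shows "(\<Sum>i\<le>e. if i = j then d i else if j = Suc i then l i else if i = Suc j then u i else 0) =
           d j + (if j = 0 then 0 else l (j - 1)) + (if j < e then u (Suc j) else 0)"
proof -
  have "(\<Sum>i\<le>e. if i = j then d i else if j = Suc i then l i else if i = Suc j then u i else 0) =
      (\<Sum>i\<le>e. (if i = j then d i else 0) + (if j > 0 \<and> i = j - 1 then l i else 0)
         + (if i = Suc j then u i else 0))"
    by (intro sum.cong) auto
  also have "\<dots> = d j + (if j = 0 then 0 else l (j - 1)) + (if j < e then u (Suc j) else 0)"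
    using assms by (cases "j = 0") (auto simp: sum.distrib sum.delta)
  finally show ?thesis .
qed

text \<open>Up to a common factor, an interior row \<open>j\<close> of the inverse sends \<open>T\<close> to
\<open>(p\<^sup>2 + 1) T j - p\<^sup>2 T (j - 1) - T (j + 1)\<close>.  This second-order difference operator annihilates the
constants and the function \<open>i \<mapsto> p\<^bsup>2i\<^esup>\<close>, which are the two branches of \<open>i \<mapsto> p\<^bsup>2 min(i,l)\<^esup>\<close>; it
detects only the kink at \<open>l\<close>.  At \<open>j = 0\<close> the branch \<open>l < j\<close> does not occur, so the row has to
annihilate only \<open>p\<^bsup>2i\<^esup>\<close>; at \<open>j = e\<close> it has to annihilate only the constants.\<close>
lemma gcd_inv_left_inverse:
  fixes p :: real
  assumes p: "p > 1" and j: "j \<le> e" and l: "l \<le> e"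
  shows "(\<Sum>i\<le>e. gcd_inv p e j i * (p ^ (2 * min i l) / p ^ l)) = (if j = l then 1 else 0)"
proof -
  have p2: "p^2 > 1" using p by simp
  define T where "T = (\<lambda>i. p ^ (2 * min i l))"
  have "(\<Sum>i\<le>e. gcd_inv p e j i * (p ^ (2 * min i l) / p ^ l)) =
     (\<Sum>i\<le>e. if i = j then gcd_inv p e j j * (p ^ (2 * min j l) / p ^ l)
            else if j = Suc i then gcd_inv p e j i * (p ^ (2 * min i l) / p ^ l)
            else if i = Suc j then gcd_inv p e j i * (p ^ (2 * min i l) / p ^ l) else 0)"
    by (intro sum.cong) (auto simp: gcd_inv_def)
  also have "\<dots> = gcd_inv p e j j * (p ^ (2 * min j l) / p ^ l) +
       (if j = 0 then 0 else gcd_inv p e j (j - 1) * (p ^ (2 * min (j - 1) l) / p ^ l)) +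
       (if j < e then gcd_inv p e j (Suc j) * (p ^ (2 * min (Suc j) l) / p ^ l) else 0)"
    by (rule sum_tridiagonal[OF j])
  also have "\<dots> = (((if j = 0 then p^2 - 1 else p^2) + (if j < e then 1 else 0)) * T j
        - (if j = 0 then 0 else p^2 * T (j - 1)) - (if j < e then T (Suc j) else 0))
      / (p ^ j * p ^ l * (p^2 - 1))"
    using p p2 by (cases j) (simp_all add: gcd_inv_def T_def divide_simps,
        simp_all add: algebra_simps power2_eq_square)
  also have "((if j = 0 then p^2 - 1 else p^2) + (if j < e then 1 else 0)) * T j
        - (if j = 0 then 0 else p^2 * T (j - 1)) - (if j < e then T (Suc j) else 0) =
      (if j = l then (p^2 - 1) * (p ^ j * p ^ l) else 0)"
  proof -
    have up: "T (Suc i) = (if i < l then p^2 * T i else T i)" for i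
      by (auto simp: T_def min_def power_add[symmetric] le_Suc_eq)
    have diag: "T l = p ^ l * p ^ l"
      by (simp add: T_def mult_2 power_add)
    have down: "p^2 * T (j - 1) = (if j \<le> l then T j else p^2 * T j)" if "j \<noteq> 0"
      using up[of "j - 1"] that by auto
    consider "l < j" | "l = j" | "j < l" by linarith
    thus ?thesis
    proof cases
      case 2
      thus ?thesis using up[of j] down diag by (auto simp: algebra_simps)
    qed (use up[of j] down l in \<open>auto simp: algebra_simps\<close>)
  qed
  finally show ?thesis using p less_imp_neq[OF p2] by simp
qed

text \<open>This is where the factors of the bound come from.  Up to scaling, an interior column is
\<open>(-p, p\<^sup>2 + 1, -p)\<close>, for which the ratio of the sum of absolute values to the sum is
\<open>(p + 1)\<^sup>2 / (p - 1)\<^sup>2\<close>, and a boundary column is \<open>(p\<^sup>2, -p)\<close>, for which it is \<open>(p + 1) / (p - 1)\<close>.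
Interior columns exist only if \<open>e \<ge> 2\<close>.\<close>
lemma gcd_inv_column_bound:
  fixes p :: real
  assumes p: "p > 1" and i: "i \<le> e" and e: "e > 0"
  shows "(\<Sum>j\<le>e. \<bar>gcd_inv p e j i\<bar>) \<le>
           ((p + 1) / (p - 1)) ^ min 2 e * (\<Sum>j\<le>e. gcd_inv p e j i)"
proof -
  have p2: "p^2 > 1" using p by simp
  define c where "c = p ^ i * (p^2 - 1)"
  have c: "c > 0" using p p2 by (simp add: c_def)
  define D where "D = (if i = 0 then p^2 - 1 else p^2) + (if i < e then 1 else 0)"
  have D: "D > 0" using p2 by (auto simp: D_def)
  \<comment> \<open>the number of off-diagonal entries in column \<open>i\<close>\<close>
  define n :: nat where "n = (if i = 0 then 0 else 1) + (if i < e then 1 else 0)"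
  have "(\<Sum>j\<le>e. gcd_inv p e j i) =
     (\<Sum>j\<le>e. if j = i then D / c else if i = Suc j then - p / c else if j = Suc i then - p / c else 0)"
    by (intro sum.cong) (auto simp: gcd_inv_def D_def c_def)
  also have "\<dots> = (D - n * p) / c"
    unfolding sum_tridiagonal[OF i] by (auto simp: n_def diff_divide_distrib)
  finally have S: "(\<Sum>j\<le>e. gcd_inv p e j i) = (D - n * p) / c" .
  have "(\<Sum>j\<le>e. \<bar>gcd_inv p e j i\<bar>) =
     (\<Sum>j\<le>e. if j = i then D / c else if i = Suc j then p / c else if j = Suc i then p / c else 0)"
  proof (intro sum.cong refl)
    fix j
    have "\<bar>gcd_inv p e j i\<bar> = \<bar>if j = i then D else if j = Suc i \<or> i = Suc j then - p else 0\<bar> / c"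
      using c by (simp add: gcd_inv_def D_def c_def)
    thus "\<bar>gcd_inv p e j i\<bar> =
        (if j = i then D / c else if i = Suc j then p / c else if j = Suc i then p / c else 0)"
      using p D by auto
  qed
  also have "\<dots> = (D + n * p) / c"
    unfolding sum_tridiagonal[OF i] by (auto simp: n_def add_divide_distrib)
  finally have A: "(\<Sum>j\<le>e. \<bar>gcd_inv p e j i\<bar>) = (D + n * p) / c" .
  have "D + n * p \<le> ((p + 1) / (p - 1)) ^ min 2 e * (D - n * p)"
  proof (cases "0 < i \<and> i < e")
    case True
    hence "min 2 e = 2" "D = p^2 + 1" "n = 2" by (auto simp: D_def n_def)
    moreover have "p^2 + 1 + 2 * p = ((p + 1) / (p - 1))^2 * (p^2 + 1 - 2 * p)"
      using p by (simp add: divide_simps) (simp add: algebra_simps power2_eq_square)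
    ultimately show ?thesis by simp
  next
    case False
    hence Dn: "D = p^2" "n = 1" using i e by (auto simp: D_def n_def)
    have "D + n * p = (p + 1) / (p - 1) * (D - n * p)"
      using p unfolding Dn by (simp add: divide_simps) (simp add: algebra_simps power2_eq_square)
    also have "\<dots> \<le> ((p + 1) / (p - 1)) ^ min 2 e * (D - n * p)"
    proof (rule mult_right_mono)
      have "((p + 1) / (p - 1)) ^ 1 \<le> ((p + 1) / (p - 1)) ^ min 2 e"
        using p e by (intro power_increasing) auto
      thus "(p + 1) / (p - 1) \<le> ((p + 1) / (p - 1)) ^ min 2 e" by simp
      show "0 \<le> D - n * p" using p by (simp add: Dn power2_eq_square)
    qed
    finally show ?thesis .
  qed
  thus ?thesis unfolding S A using c by (simp add: divide_right_mono)
qed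

lemma sum_divisors_prime_power_mult:
  fixes p m :: nat and f :: "nat \<Rightarrow> 'a :: comm_monoid_add"
  assumes p: "prime p" and m: "\<not> p dvd m"
  shows "(\<Sum>d | d dvd p ^ e * m. f d) = (\<Sum>j\<le>e. \<Sum>d | d dvd m. f (p ^ j * d))"
proof -
  have m0: "m > 0" using m by (cases m) auto
  have inj: "j = j' \<and> d = d'" if "d dvd m" "d' dvd m" "p ^ j * d = p ^ j' * d'" for j j' d d'
  proof -
    have mult: "multiplicity p (p ^ i * d) = i" if "d dvd m" for i d
      using that m m0 p by (intro multiplicity_decomposeI[where x' = d]) (auto dest: dvd_trans)
    have "j = j'" using mult that by metis
    thus ?thesis using that(3) p by (auto simp: prime_gt_0_nat)
  qed
  have "{d. d dvd p ^ e * m} = (\<lambda>(j, d). p ^ j * d) ` ({..e} \<times> {d. d dvd m})"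
  proof (intro equalityI subsetI)
    fix d assume "d \<in> {d. d dvd p ^ e * m}"
    then obtain b c where bc: "d = b * c" "b dvd p ^ e" "c dvd m"
      using division_decomp[of d "p ^ e" m] by auto
    then obtain j where "j \<le> e" "b = p ^ j" using p by (auto simp: divides_primepow_nat)
    thus "d \<in> (\<lambda>(j, d). p ^ j * d) ` ({..e} \<times> {d. d dvd m})" using bc by force
  next
    fix d assume "d \<in> (\<lambda>(j, d). p ^ j * d) ` ({..e} \<times> {d. d dvd m})"
    thus "d \<in> {d. d dvd p ^ e * m}" by (auto intro!: mult_dvd_mono le_imp_power_dvd)
  qed
  moreover have "inj_on (\<lambda>(j, d). p ^ j * d) ({..e} \<times> {d. d dvd m})"
  proof (rule inj_onI)
    fix x y assume "x \<in> {..e} \<times> {d. d dvd m}" "y \<in> {..e} \<times> {d. d dvd m}"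
      and "(\<lambda>(j, d). p ^ j * d) x = (\<lambda>(j, d). p ^ j * d) y"
    thus "x = y" using inj[of "snd x" "snd y" "fst x" "fst y"]
      by (simp add: case_prod_unfold mem_Times_iff prod_eq_iff)
  qed
  ultimately have "(\<Sum>d | d dvd p ^ e * m. f d) =
      (\<Sum>(j, d) \<in> {..e} \<times> {d. d dvd m}. f (p ^ j * d))"
    by (simp add: sum.reindex case_prod_unfold)
  thus ?thesis by (simp add: sum.cartesian_product)
qed

lemma gcd_prime_power_mult:
  fixes p :: nat
  assumes p: "prime p" and d: "\<not> p dvd d" and d': "\<not> p dvd d'"
  shows "gcd (p ^ i * d) (p ^ j * d') = p ^ min i j * gcd d d'"
proof -
  have *: "gcd (p ^ i * d) (p ^ j * d') = p ^ i * gcd d d'"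
    if "i \<le> j" "\<not> p dvd d" for i j d d'
  proof -
    have "p ^ j = p ^ i * p ^ (j - i)" using that by (simp flip: power_add)
    hence "gcd (p ^ i * d) (p ^ j * d') = p ^ i * gcd d (p ^ (j - i) * d')"
      by (metis gcd_mult_distrib_nat mult.assoc)
    moreover have "coprime d (p ^ (j - i))"
      using p that by (metis coprime_commute coprime_power_right_iff prime_imp_coprime)
    ultimately show ?thesis by (simp add: gcd_mult_right_left_cancel)
  qed
  show ?thesis
  proof (cases "i \<le> j")
    case True
    thus ?thesis using *[OF True d] by (simp add: min_def)
  next
    case False
    thus ?thesis using *[of j i d' d] d' by (simp add: min_def gcd.commute)
  qed
qed

text \<open>The matrix \<open>gcd(c, \<delta>)\<^sup>2 / \<delta>\<close> indexed by the divisors of \<open>N\<close> is the tensor product of its analogues for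
the prime powers exactly dividing \<open>N\<close>, so the column bounds multiply.  The induction splits off
one prime power \<open>p\<^bsup>e\<^esup>\<close>, writes \<open>N = p\<^bsup>e\<^esup> m\<close>, and applies only the \<open>p\<close>-part of the matrix to \<open>r\<close>.  The
resulting functions \<open>w i\<close> on the divisors of \<open>m\<close> satisfy the induction hypothesis, and \<open>r\<close> is
recovered from them through the columns of the inverse of the \<open>p\<close>-part.\<close>
lemma l1_norm_le_of_gcd_sums_nonneg:
  fixes N :: nat and r :: "nat \<Rightarrow> real"
  assumes "N > 0"
    and "\<And>c. c dvd N \<Longrightarrow> (\<Sum>\<delta> | \<delta> dvd N. real (gcd c \<delta>)^2 / real \<delta> * r \<delta>) \<ge> 0"
  shows "(\<Sum>\<delta> | \<delta> dvd N. \<bar>r \<delta>\<bar>) \<le>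
           (\<Prod>p | prime p \<and> p dvd N. ((real p + 1) / (real p - 1)) ^ min 2 (multiplicity p N))
             * (\<Sum>\<delta> | \<delta> dvd N. r \<delta>)"
  using assms
proof (induction N arbitrary: r rule: less_induct)
  case (less N)
  define C where "C = (\<lambda>n. \<Prod>p | prime p \<and> p dvd n.
    ((real p + 1) / (real p - 1)) ^ min 2 (multiplicity p n))"
  show ?case
  proof (cases "N = 1")
    case True
    thus ?thesis using less.prems(2)[of 1] by simp
  next
    case False
    then obtain p where p: "prime p" "p dvd N" using prime_factor_nat by blast
    have "N \<noteq> 0" "\<not> is_unit p" using less.prems p by auto
    then obtain m where m: "N = p ^ multiplicity p N * m" "\<not> p dvd m"
      using multiplicity_decompose' by blast
    define e where "e = multiplicity p N"
    have N: "N = p ^ e * m" using m by (simp add: e_def)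
    have e: "e > 0" using p less.prems by (simp add: e_def prime_multiplicity_gt_zero_iff)
    have m0: "m > 0" using m by (cases m) auto
    have p1: "real p > 1" using p prime_gt_1_nat by simp
    have "1 < p ^ e" using p e prime_gt_1_nat one_less_power by blast
    hence mN: "m < N" using m0 unfolding N by simp
    \<comment> \<open>the \<open>p\<close>-part of the gcd matrix applied to \<open>r\<close>\<close>
    define w where "w = (\<lambda>i \<delta>. \<Sum>l\<le>e. real p ^ (2 * min i l) / real p ^ l * r (p ^ l * \<delta>))"
    have ndvd: "\<not> p dvd d" if "d dvd m" for d using that m dvd_trans by blast
    have w_bound: "(\<Sum>\<delta> | \<delta> dvd m. \<bar>w i \<delta>\<bar>) \<le> C m * (\<Sum>\<delta> | \<delta> dvd m. w i \<delta>)" if i: "i \<le> e" for i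
      unfolding C_def
    proof (rule less.IH[OF mN m0])
      fix c assume c: "c dvd m"
      have "p ^ i * c dvd N" unfolding N using i c by (intro mult_dvd_mono le_imp_power_dvd)
      hence "0 \<le> (\<Sum>\<delta> | \<delta> dvd N. real (gcd (p ^ i * c) \<delta>)^2 / real \<delta> * r \<delta>)"
        by (rule less.prems(2))
      also have "\<dots> = (\<Sum>l\<le>e. \<Sum>\<delta> | \<delta> dvd m.
          real (gcd (p ^ i * c) (p ^ l * \<delta>))^2 / real (p ^ l * \<delta>) * r (p ^ l * \<delta>))"
        unfolding N by (rule sum_divisors_prime_power_mult[OF p(1) m(2)])
      also have "\<dots> = (\<Sum>l\<le>e. \<Sum>\<delta> | \<delta> dvd m. real (gcd c \<delta>)^2 / real \<delta> *
          (real p ^ (2 * min i l) / real p ^ l * r (p ^ l * \<delta>)))"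
      proof (intro sum.cong refl)
        fix l \<delta> assume "\<delta> \<in> {\<delta>. \<delta> dvd m}"
        hence "real (gcd (p ^ i * c) (p ^ l * \<delta>))^2 = real (gcd c \<delta>)^2 * real p ^ (2 * min i l)"
          using gcd_prime_power_mult[OF p(1) ndvd[OF c] ndvd]
          by (simp add: power_mult_distrib power_mult mult.commute[of 2])
        thus "real (gcd (p ^ i * c) (p ^ l * \<delta>))^2 / real (p ^ l * \<delta>) * r (p ^ l * \<delta>) =
            real (gcd c \<delta>)^2 / real \<delta> * (real p ^ (2 * min i l) / real p ^ l * r (p ^ l * \<delta>))"
          by (simp only: of_nat_mult of_nat_power times_divide_eq_left times_divide_eq_right
                divide_divide_eq_left mult_ac)
      qed
      also have "\<dots> = (\<Sum>\<delta> | \<delta> dvd m. real (gcd c \<delta>)^2 / real \<delta> * w i \<delta>)"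
        unfolding w_def sum_distrib_left by (rule sum.swap)
      finally show "0 \<le> (\<Sum>\<delta> | \<delta> dvd m. real (gcd c \<delta>)^2 / real \<delta> * w i \<delta>)" .
    qed
    have r_eq: "r (p ^ j * \<delta>) = (\<Sum>i\<le>e. gcd_inv p e j i * w i \<delta>)" if "j \<le> e" for j \<delta>
    proof -
      have "(\<Sum>i\<le>e. gcd_inv p e j i * w i \<delta>) =
          (\<Sum>l\<le>e. (\<Sum>i\<le>e. gcd_inv p e j i * (real p ^ (2 * min i l) / real p ^ l)) * r (p ^ l * \<delta>))"
        unfolding w_def sum_distrib_left sum_distrib_right
        by (subst sum.swap) (simp add: mult.assoc)
      also have "\<dots> = (\<Sum>l\<le>e. (if j = l then 1 else 0) * r (p ^ l * \<delta>))"
        by (intro sum.cong refl, subst gcd_inv_left_inverse[OF p1 that]) auto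
      also have "\<dots> = (\<Sum>l\<le>e. if l = j then r (p ^ l * \<delta>) else 0)"
        by (intro sum.cong) auto
      also have "\<dots> = r (p ^ j * \<delta>)" using that by (simp add: sum.delta)
      finally show ?thesis by simp
    qed
    define K where "K = ((real p + 1) / (real p - 1)) ^ min 2 e"
    have "(\<Sum>\<delta> | \<delta> dvd N. \<bar>r \<delta>\<bar>) = (\<Sum>j\<le>e. \<Sum>\<delta> | \<delta> dvd m. \<bar>r (p ^ j * \<delta>)\<bar>)"
      unfolding N by (rule sum_divisors_prime_power_mult[OF p(1) m(2)])
    also have "\<dots> = (\<Sum>j\<le>e. \<Sum>\<delta> | \<delta> dvd m. \<bar>\<Sum>i\<le>e. gcd_inv p e j i * w i \<delta>\<bar>)"
      by (intro sum.cong refl) (simp add: r_eq)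
    also have "\<dots> \<le> (\<Sum>j\<le>e. \<Sum>\<delta> | \<delta> dvd m. \<Sum>i\<le>e. \<bar>gcd_inv p e j i\<bar> * \<bar>w i \<delta>\<bar>)"
      by (intro sum_mono order.trans[OF sum_abs]) (simp add: abs_mult)
    also have "\<dots> = (\<Sum>j\<le>e. \<Sum>i\<le>e. \<bar>gcd_inv p e j i\<bar> * (\<Sum>\<delta> | \<delta> dvd m. \<bar>w i \<delta>\<bar>))"
      unfolding sum_distrib_left by (rule sum.cong[OF refl], rule sum.swap)
    also have "\<dots> = (\<Sum>i\<le>e. (\<Sum>j\<le>e. \<bar>gcd_inv p e j i\<bar>) * (\<Sum>\<delta> | \<delta> dvd m. \<bar>w i \<delta>\<bar>))"
      unfolding sum_distrib_right by (rule sum.swap)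
    also have "\<dots> \<le> (\<Sum>i\<le>e. (K * (\<Sum>j\<le>e. gcd_inv p e j i)) * (C m * (\<Sum>\<delta> | \<delta> dvd m. w i \<delta>)))"
    proof (intro sum_mono mult_mono w_bound)
      fix i assume i: "i \<in> {..e}"
      show bd: "(\<Sum>j\<le>e. \<bar>gcd_inv p e j i\<bar>) \<le> K * (\<Sum>j\<le>e. gcd_inv p e j i)"
        unfolding K_def using i e by (intro gcd_inv_column_bound p1) auto
      show "0 \<le> K * (\<Sum>j\<le>e. gcd_inv p e j i)" 
        by (rule order.trans[OF _ bd]) (simp add: sum_nonneg)
    qed (auto simp: sum_nonneg)
    also have "\<dots> = K * C m * (\<Sum>i\<le>e. \<Sum>j\<le>e. \<Sum>\<delta> | \<delta> dvd m. gcd_inv p e j i * w i \<delta>)"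
      unfolding sum_product[symmetric] sum_distrib_left[of "K * C m" _ "{..e}"]
      by (simp only: mult_ac)
    also have "(\<Sum>i\<le>e. \<Sum>j\<le>e. \<Sum>\<delta> | \<delta> dvd m. gcd_inv p e j i * w i \<delta>) =
        (\<Sum>j\<le>e. \<Sum>\<delta> | \<delta> dvd m. \<Sum>i\<le>e. gcd_inv p e j i * w i \<delta>)"
      by (subst sum.swap, rule sum.cong[OF refl], rule sum.swap)
    also have "\<dots> = (\<Sum>j\<le>e. \<Sum>\<delta> | \<delta> dvd m. r (p ^ j * \<delta>))"
      by (intro sum.cong refl) (simp add: r_eq)
    also have "\<dots> = (\<Sum>\<delta> | \<delta> dvd N. r \<delta>)"
      unfolding N by (rule sum_divisors_prime_power_mult[OF p(1) m(2), symmetric])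
    also have "K * C m = C N"
    proof -
      have "q dvd N \<longleftrightarrow> q = p \<or> q dvd m" if "prime q" for q
        unfolding N using that p(1) e primes_dvd_imp_eq[of q p]
        by (auto simp: prime_dvd_mult_iff prime_dvd_power_iff)
      hence "{q. prime q \<and> q dvd N} = insert p {q. prime q \<and> q dvd m}"
        using p(1) by blast
      moreover have "finite {q. prime q \<and> q dvd m}" using m0 by simp
      moreover have "p \<notin> {q. prime q \<and> q dvd m}" using m by simp
      moreover have "multiplicity q N = multiplicity q m" if "prime q" "q dvd m" for q
      proof -
        have "q \<noteq> p" using that m by auto
        hence "multiplicity q (p ^ e) = 0"
          using that(1) p(1) by (rule multiplicity_distinct_prime_power[rotated 2])
        thus ?thesis unfolding N using that p m0
          by (subst prime_elem_multiplicity_mult_distrib) auto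
      qed
      ultimately show ?thesis
        unfolding C_def K_def e_def by simp
    qed
    finally show ?thesis unfolding C_def .
  qed
qed


section \<open>The eta function as the exponential of a Lambert series\<close>

text \<open>The terms with \<open>m = 0\<close> here and in the series below vanish by the convention \<open>x / 0 = 0\<close>, so that
all series over \<open>m \<ge> 1\<close> can be indexed by all natural numbers.\<close>
definition lambert :: "complex \<Rightarrow> complex" where
  "lambert q = (\<Sum>m. q ^ m / (of_nat m * (1 - q ^ m)))"

lemma norm_one_minus_power_ge:
  fixes q :: complex
  assumes "norm q < 1" "m > 0"
  shows "1 - norm q \<le> norm (1 - q ^ m)"
proof -
  have "norm q ^ m \<le> norm q ^ 1"
    using assms by (intro power_decreasing) auto
  moreover have "1 - norm q ^ m \<le> norm (1 - q ^ m)"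
    using norm_triangle_ineq2[of 1 "q ^ m"] by (simp add: norm_power)
  ultimately show ?thesis by simp
qed

lemma power_neq_one:
  fixes q :: complex
  assumes "norm q < 1" "m > 0"
  shows "q ^ m \<noteq> 1"
  using norm_one_minus_power_ge[OF assms] assms by auto

lemma norm_lambert_term_le:
  fixes q :: complex
  assumes q: "norm q < 1"
  shows "norm (q ^ m / (of_nat m * (1 - q ^ m))) \<le> norm q ^ m / (1 - norm q)"
proof (cases "m = 0")
  case False
  have "1 * (1 - norm q) \<le> real m * norm (1 - q ^ m)"
    using False q norm_one_minus_power_ge[OF q] by (intro mult_mono) auto
  thus ?thesis
    using q by (simp add: norm_divide norm_mult norm_power divide_left_mono frac_le)
qed (use q in simp)

lemma lambert_sums:
  assumes "norm q < 1"
  shows "(\<lambda>m. q ^ m / (of_nat m * (1 - q ^ m))) sums lambert q"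
proof -
  have "summable (\<lambda>m. norm q ^ m / (1 - norm q))"
    using assms by (intro summable_divide summable_geometric) auto
  hence "summable (\<lambda>m. q ^ m / (of_nat m * (1 - q ^ m)))"
    by (rule summable_comparison_test[rotated]) (use norm_lambert_term_le[OF assms] in auto)
  thus ?thesis unfolding lambert_def by (rule summable_sums)
qed

text \<open>Expanding the logarithm of each factor into its power series and summing the finite geometric
progression over \<open>n < K\<close> first keeps the interchange of summations finite.  What is left is one
limit in \<open>K\<close>, which dominated convergence handles.\<close>
lemma finite_euler_product:
  fixes q :: complex
  assumes q: "norm q < 1"
  shows "(\<Prod>n<K. 1 - q ^ Suc n) =
           exp (- (\<Sum>m. q ^ m / (of_nat m * (1 - q ^ m)) * (1 - (q ^ m) ^ K)))"
proof -
  have nq: "norm (q ^ Suc n) < 1" for n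
    using q by (simp add: norm_power power_less_one_iff del: power_Suc)
  have "(\<lambda>m. \<Sum>n<K. - ((q ^ Suc n) ^ m) / of_nat m) sums (\<Sum>n<K. ln (1 - q ^ Suc n))"
  proof (intro sums_sum)
    fix n
    show "(\<lambda>m. - ((q ^ Suc n) ^ m) / of_nat m) sums ln (1 - q ^ Suc n)"
      using Ln_series'[of "- (q ^ Suc n)"] nq[of n] by simp
  qed
  also have "(\<lambda>m. \<Sum>n<K. - ((q ^ Suc n) ^ m) / of_nat m) =
      (\<lambda>m. - (q ^ m / (of_nat m * (1 - q ^ m)) * (1 - (q ^ m) ^ K)))"
  proof
    fix m
    show "(\<Sum>n<K. - ((q ^ Suc n) ^ m) / of_nat m) =
            - (q ^ m / (of_nat m * (1 - q ^ m)) * (1 - (q ^ m) ^ K))"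
    proof (cases "m = 0")
      case False
      hence ne: "q ^ m \<noteq> 1" using power_neq_one[OF q] by simp
      have "(\<Sum>n<K. - ((q ^ Suc n) ^ m) / of_nat m) = - (q ^ m / of_nat m * (\<Sum>n<K. (q ^ m) ^ n))"
        by (simp add: sum_distrib_left sum_negf power_mult_distrib flip: power_mult)
           (simp add: mult.commute)
      also have "(\<Sum>n<K. (q ^ m) ^ n) = (1 - (q ^ m) ^ K) / (1 - q ^ m)"
        by (rule sum_gp_strict[THEN trans]) (use ne in simp)
      finally show ?thesis by simp
    qed simp
  qed
  finally have "(\<lambda>m. - (q ^ m / (of_nat m * (1 - q ^ m)) * (1 - (q ^ m) ^ K))) sums
      (\<Sum>n<K. ln (1 - q ^ Suc n))" .
  from sums_unique[OF sums_minus[OF this]]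
  have "- (\<Sum>m. q ^ m / (of_nat m * (1 - q ^ m)) * (1 - (q ^ m) ^ K)) =
      (\<Sum>n<K. ln (1 - q ^ Suc n))"
    by (simp only: minus_minus minus_equation_iff)
  moreover have "exp (\<Sum>n<K. ln (1 - q ^ Suc n)) = (\<Prod>n<K. 1 - q ^ Suc n)"
    unfolding exp_sum[OF finite_lessThan]
  proof (intro prod.cong refl)
    fix n
    have "1 - q ^ Suc n \<noteq> 0" using power_neq_one[OF q, of "Suc n"] by simp
    thus "exp (ln (1 - q ^ Suc n)) = 1 - q ^ Suc n" by (rule exp_Ln)
  qed
  ultimately show ?thesis by (simp only:)
qed

lemma euler_product_eq_exp_lambert:
  assumes q: "norm q < 1"
  shows "(\<Prod>n. 1 - q ^ Suc n) = exp (- lambert q)"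
proof -
  let ?t = "\<lambda>m. q ^ m / (of_nat m * (1 - q ^ m))"
  have "(\<lambda>K. \<Sum>m. ?t m * (1 - (q ^ m) ^ K)) \<longlonglongrightarrow> (\<Sum>m. ?t m)"
  proof (rule tannerys_theorem[THEN conjunct2, THEN conjunct2])
    fix m
    show "(\<lambda>K. ?t m * (1 - (q ^ m) ^ K)) \<longlonglongrightarrow> ?t m"
    proof (cases "m = 0")
      case False
      hence "norm (q ^ m) < 1"
        using q by (simp add: norm_power power_less_one_iff)
      hence *: "(\<lambda>K. (q ^ m) ^ K) \<longlonglongrightarrow> 0" by (rule LIMSEQ_power_zero)
      have "(\<lambda>K. ?t m * (1 - (q ^ m) ^ K)) \<longlonglongrightarrow> ?t m * (1 - 0)"
        by (intro tendsto_intros *)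
      thus ?thesis by (simp only: diff_zero mult_1_right)
    qed simp
  next
    have "norm (?t m * (1 - (q ^ m) ^ K)) \<le> norm q ^ m / (1 - norm q) * 2" for m K
    proof -
      have "norm ((q ^ m) ^ K) \<le> 1"
        using q by (simp add: norm_power power_le_one)
      hence "norm (1 - (q ^ m) ^ K) \<le> 2"
        using norm_triangle_ineq4[of 1 "(q ^ m) ^ K"] by simp
      thus ?thesis
        unfolding norm_mult using q norm_lambert_term_le[OF q]
        by (intro mult_mono) auto
    qed
    thus "\<forall>\<^sub>F (m, K) in sequentially \<times>\<^sub>F sequentially.
            norm (?t m * (1 - (q ^ m) ^ K)) \<le> norm q ^ m / (1 - norm q) * 2"
      by (intro always_eventually) auto
    show "summable (\<lambda>m. norm q ^ m / (1 - norm q) * 2)"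
      using q by (intro summable_mult2 summable_divide summable_geometric) auto
  qed simp
  hence "(\<lambda>K. exp (- (\<Sum>m. ?t m * (1 - (q ^ m) ^ K)))) \<longlonglongrightarrow> exp (- lambert q)"
    unfolding lambert_def by (intro tendsto_intros)
  hence "(\<lambda>K. \<Prod>n<K. 1 - q ^ Suc n) \<longlonglongrightarrow> exp (- lambert q)"
    using finite_euler_product[OF q] by simp
  hence "(\<lambda>n. 1 - q ^ Suc n) has_prod exp (- lambert q)"
    unfolding has_prod_def raw_has_prod_def
    by (simp add: LIMSEQ_lessThan_iff_atMost)
  thus ?thesis by (rule has_prod_unique[symmetric])
qed

lemma
  assumes "Im z > 0"
  shows dedekind_eta_nonzero: "dedekind_eta z \<noteq> 0"
    and ln_norm_dedekind_eta: "ln (norm (dedekind_eta z)) =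
          - (pi * Im z / 12) - Re (lambert (exp (2 * of_real pi * \<i> * z)))"
proof -
  have "norm (exp (2 * of_real pi * \<i> * z)) < 1" using assms by simp
  hence eq: "dedekind_eta z = exp (2 * of_real pi * \<i> * z / 24)
      * exp (- lambert (exp (2 * of_real pi * \<i> * z)))"
    unfolding dedekind_eta_def by (subst euler_product_eq_exp_lambert) auto
  show "dedekind_eta z \<noteq> 0" unfolding eq by simp
  show "ln (norm (dedekind_eta z)) =
          - (pi * Im z / 12) - Re (lambert (exp (2 * of_real pi * \<i> * z)))"
    unfolding eq norm_mult norm_exp_eq_Re by (subst ln_mult) auto
qed

text \<open>The combination \<open>L(q) - 2 L(q\<^sup>2)\<close> cancels the pole of the Lambert series \<open>L\<close> at \<open>q = 1\<close> and thereby exposes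
the logarithmic term.  Indeed its \<open>m\<close>-th term is \<open>w / (m (1 + w))\<close> with \<open>w = q\<^bsup>m\<^esup>\<close>, and
\<open>w / 2 \<le> w / (1 + w) \<le> w - w\<^sup>2 / 2\<close>; after division by \<open>m\<close> both bounds are
terms of logarithmic series.\<close>
lemma lambert_duplication_bounds:
  fixes q :: real
  assumes q: "0 < q" "q < 1"
  defines "D \<equiv> Re (lambert (of_real q)) - 2 * Re (lambert (of_real (q ^ 2)))"
  shows "- ln (1 - q) / 2 \<le> D" and "D \<le> - ln (1 - q) / 2 + ln (1 + q) / 2"
proof -
  have ReL: "(\<lambda>m. x ^ m / (real m * (1 - x ^ m))) sums Re (lambert (of_real x))"
    if x: "0 < x" "x < 1" for x :: real
  proof -
    have "(\<lambda>m. Re (of_real x ^ m / (of_nat m * (1 - of_real x ^ m)))) sums Re (lambert (of_real x))"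
      using x by (intro sums_Re lambert_sums) auto
    moreover have "Re (of_real x ^ m / (of_nat m * (1 - of_real x ^ m))) =
        x ^ m / (real m * (1 - x ^ m))" for m
    proof -
      have "of_real x ^ m / (of_nat m * (1 - of_real x ^ m)) =
          complex_of_real (x ^ m / (real m * (1 - x ^ m)))" by simp
      thus ?thesis by (metis Re_complex_of_real)
    qed
    ultimately show ?thesis by simp
  qed
  have q2: "0 < q ^ 2" "q ^ 2 < 1" using q by (auto simp: power_less_one_iff)
  have "(\<lambda>m. q ^ m / (real m * (1 - q ^ m)) - 2 * ((q^2) ^ m / (real m * (1 - (q^2) ^ m)))) sums D"
    unfolding D_def by (intro sums_diff sums_mult ReL q q2)
  moreover have "q ^ m / (real m * (1 - q ^ m)) - 2 * ((q^2) ^ m / (real m * (1 - (q^2) ^ m))) =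
      q ^ m / (real m * (1 + q ^ m))" for m
  proof (cases "m = 0")
    case False
    define w where "w = q ^ m"
    have w: "0 < w" "w < 1" using q False by (auto simp: w_def power_less_one_iff)
    have *: "(q^2) ^ m = w ^ 2" by (simp add: w_def flip: power_mult) (simp add: mult.commute)
    have "w^2 < 1" using w by (auto simp: power_less_one_iff)
    hence "w / (1 - w) - 2 * (w^2 / (1 - w^2)) = w / (1 + w)"
      using w by (simp add: divide_simps) (simp add: algebra_simps power2_eq_square)
    hence "(w / (1 - w) - 2 * (w^2 / (1 - w^2))) / m = w / (1 + w) / m" by simp
    thus ?thesis unfolding * w_def[symmetric]
      by (simp add: diff_divide_distrib mult.commute)
  qed simp
  ultimately have D: "(\<lambda>m. q ^ m / (real m * (1 + q ^ m))) sums D" by simp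
  have L: "(\<lambda>m. x ^ m / real m) sums (- ln (1 - x))" if "0 < x" "x < 1" for x :: real
    using sums_minus[OF ln_series'[of "-x"]] that by simp
  have bounds: "q ^ m / real m / 2 \<le> q ^ m / (real m * (1 + q ^ m)) \<and>
      q ^ m / (real m * (1 + q ^ m)) \<le> q ^ m / real m - (q^2) ^ m / real m / 2" for m
  proof (cases "m = 0")
    case False
    define w where "w = q ^ m"
    have w: "0 < w" "w < 1" using q False by (auto simp: w_def power_less_one_iff)
    have *: "(q^2) ^ m = w ^ 2" by (simp add: w_def flip: power_mult) (simp add: mult.commute)
    have "w / 2 \<le> w / (1 + w)" using w by (simp add: field_simps)
    hence 1: "w / 2 / m \<le> w / (1 + w) / m" by (rule divide_right_mono) simp
    have "0 \<le> w * (w * (1 - w))" using w by simp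
    hence "w / (1 + w) \<le> w - w^2 / 2" 
      using w by (simp add: field_simps power2_eq_square)
    hence 2: "w / (1 + w) / m \<le> (w - w^2 / 2) / m" by (rule divide_right_mono) simp
    show ?thesis unfolding * w_def[symmetric] using 1 2
      by (simp add: diff_divide_distrib mult.commute)
  qed simp
  show "- ln (1 - q) / 2 \<le> D"
    by (rule sums_le[OF _ sums_divide[OF L[OF q]] D]) (use bounds in blast)
  have "D \<le> - ln (1 - q) - (- ln (1 - q^2) / 2)"
    by (rule sums_le[OF _ D sums_diff[OF L[OF q] sums_divide[OF L[OF q2]]]]) (use bounds in blast)
  also have "ln (1 - q^2) = ln (1 - q) + ln (1 + q)"
  proof -
    have "1 - q^2 = (1 - q) * (1 + q)" by (simp add: algebra_simps power2_eq_square)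
    thus ?thesis using q by (simp add: ln_mult)
  qed
  finally show "D \<le> - ln (1 - q) / 2 + ln (1 + q) / 2" by argo
qed


section \<open>Asymptotics of eta near rational points\<close>

lemma ln_power_int: "ln (x powi n) = real_of_int n * ln (x :: real)" if "x > 0"
proof -
  have "x powi n = x powr real_of_int n" using that by (simp add: powr_real_of_int')
  thus ?thesis using that by (simp add: ln_powr)
qed

lemma exp_rational_power:
  fixes a c m :: nat and y :: real
  shows "exp (2 * of_real pi * \<i> * (of_nat a / of_nat c + \<i> * of_real y)) ^ m =
           exp (2 * of_real pi * \<i> * of_nat (m * a) / of_nat c) * of_real (exp (- (2 * pi * m * y)))"
  unfolding exp_of_nat_mult[symmetric] exp_of_real[symmetric] exp_add[symmetric]
  by (rule arg_cong[of _ _ exp]) (simp add: algebra_simps)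

text \<open>A majorant that does not depend on \<open>y\<close>, which makes dominated convergence applicable
as \<open>y\<close> tends to \<open>0\<close>.\<close>
lemma norm_scaled_lambert_term_le:
  fixes q :: complex
  assumes y: "y > 0" and q: "norm q = exp (- (2 * pi * y))"
  shows "norm (of_real y * (q ^ m / (of_nat m * (1 - q ^ m)))) \<le> 1 / (2 * pi * real m ^ 2)"
proof (cases "m = 0")
  case False
  define u where "u = 2 * pi * m * y"
  have u: "u > 0" using y False by (simp add: u_def)
  have w: "norm (q ^ m) = exp (- u)"
    by (simp add: norm_power q u_def flip: exp_of_nat_mult)
  have "u * exp (- u) \<le> 1 - exp (- u)"
    using exp_ge_add_one_self[of u] by (simp add: exp_minus field_simps)
  also have "\<dots> \<le> norm (1 - q ^ m)"
    using norm_triangle_ineq2[of 1 "q ^ m"] w by simp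
  finally have *: "u * exp (- u) \<le> norm (1 - q ^ m)" .
  moreover have pos: "0 < norm (1 - q ^ m)"
    by (rule less_le_trans[OF _ *]) (use u in simp)
  ultimately have "exp (- u) / norm (1 - q ^ m) \<le> 1 / u"
    using u by (simp add: field_simps)
  hence "y / m * (exp (- u) / norm (1 - q ^ m)) \<le> y / m * (1 / u)"
    using y by (intro mult_left_mono) auto
  also have "\<dots> = 1 / (2 * pi * real m ^ 2)"
    using y False by (simp add: u_def power2_eq_square)
  finally show ?thesis
    using y w by (simp add: norm_mult norm_divide)
qed simp

text \<open>The \<open>m\<close>-th term blows up like \<open>1 / y\<close> exactly if \<open>q\<^bsup>m\<^esup>\<close> tends to \<open>1\<close>, that is, if the root of unity
\<open>exp (2\<pi>i m a / c)\<close> is trivial.\<close>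
lemma scaled_lambert_term_tendsto:
  fixes a c m :: nat
  assumes c: "c > 0"
  defines "q \<equiv> \<lambda>y::real. exp (2 * of_real pi * \<i> * (of_nat a / of_nat c + \<i> * of_real y))"
  shows "((\<lambda>y. of_real y * (q y ^ m / (of_nat m * (1 - q y ^ m)))) \<longlongrightarrow>
            of_real (if c dvd m * a then 1 / (2 * pi * real m ^ 2) else 0)) (at_right 0)"
proof (cases "m = 0")
  case False
  define \<zeta> where "\<zeta> = exp (2 * of_real pi * \<i> * of_nat (m * a) / of_nat c)"
  have q: "q y ^ m = \<zeta> * of_real (exp (- (2 * pi * m * y)))" for y
    unfolding q_def \<zeta>_def by (rule exp_rational_power)
  have \<zeta>: "\<zeta> = 1 \<longleftrightarrow> c dvd m * a"
    unfolding \<zeta>_def using c by (intro complex_root_unity_eq_1) simp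
  show ?thesis
  proof (cases "c dvd m * a")
    case True
    define x where "x = real m"
    have "x > 0" using False by (simp add: x_def)
    hence "((\<lambda>y. y * (exp (- (2 * pi * x * y)) / (x * (1 - exp (- (2 * pi * x * y)))))) \<longlongrightarrow>
        1 / (2 * pi * x ^ 2)) (at_right 0)"
      by (real_asymp simp: power2_eq_square field_simps)
    hence "((\<lambda>y. complex_of_real (y * (exp (- (2 * pi * x * y)) / (x * (1 - exp (- (2 * pi * x * y))))))) \<longlongrightarrow>
        of_real (1 / (2 * pi * x ^ 2))) (at_right 0)"
      by (rule tendsto_of_real)
    thus ?thesis using True \<zeta> unfolding q by (simp add: x_def)
  next
    case False
    hence "\<zeta> \<noteq> 1" using \<zeta> by simp
    have "((\<lambda>y. complex_of_real y * (\<zeta> * of_real (exp (- (2 * pi * m * y))) /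
          (of_nat m * (1 - \<zeta> * of_real (exp (- (2 * pi * m * y))))))) \<longlongrightarrow>
        of_real 0 * (\<zeta> * of_real (exp (- (2 * pi * m * 0))) /
          (of_nat m * (1 - \<zeta> * of_real (exp (- (2 * pi * m * 0))))))) (at_right 0)"
      by (intro tendsto_intros) (use \<open>m \<noteq> 0\<close> \<open>\<zeta> \<noteq> 1\<close> in auto)
    thus ?thesis using False unfolding q by simp
  qed
qed simp

text \<open>The condition \<open>c dvd m * a\<close> says that \<open>m\<close> is a multiple of the denominator \<open>c / gcd a c\<close> of \<open>a / c\<close> in lowest terms,
so the series is a multiple of \<open>\<zeta>(2) = \<pi>\<^sup>2 / 6\<close>.\<close>
lemma sums_multiples_inverse_squares:
  fixes a c :: nat
  assumes c: "c > 0"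
  shows "(\<lambda>m. if c dvd m * a then 1 / (2 * pi * real m ^ 2) else 0) sums
           (pi / 12 * (real (gcd a c) / real c) ^ 2)"
proof -
  define c' where "c' = c div gcd a c"
  have c': "c = c' * gcd a c" "c' > 0"
    using c by (auto simp: c'_def div_greater_zero_iff intro: gcd_le2_nat)
  have dvd: "c dvd m * a \<longleftrightarrow> c' dvd m" for m
  proof -
    obtain a' where a': "a = a' * gcd a c" by (metis dvd_def gcd_dvd1 mult.commute)
    have g: "gcd a c \<noteq> 0" using c by simp
    have "coprime c' a'"
      using div_gcd_coprime[of c a] c a' g unfolding c'_def
      by (metis gcd.commute nonzero_mult_div_cancel_right not_gr_zero)
    have "c dvd m * a \<longleftrightarrow> c' * gcd a c dvd (m * a') * gcd a c"
      using c' a' by (metis mult.assoc)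
    also have "\<dots> \<longleftrightarrow> c' dvd m * a'" using g by simp
    also have "\<dots> \<longleftrightarrow> c' dvd m" using \<open>coprime c' a'\<close> by (simp add: coprime_dvd_mult_left_iff)
    finally show ?thesis .
  qed
  have "(\<lambda>n. 1 / (real (Suc n))^2) sums (pi^2 / 6)"
    using inverse_squares_sums by (simp add: add.commute)
  hence "(\<lambda>n. 1 / (real n)^2) sums (pi^2 / 6)"
    by (subst (asm) sums_Suc_iff) simp
  hence "(\<lambda>n. 1 / (real n)^2 * (1 / (2 * pi * real c' ^ 2))) sums (pi^2 / 6 * (1 / (2 * pi * real c' ^ 2)))"
    by (rule sums_mult2)
  also have "(\<lambda>n. 1 / (real n)^2 * (1 / (2 * pi * real c' ^ 2))) =
      (\<lambda>n. if c' dvd c' * n then 1 / (2 * pi * real (c' * n) ^ 2) else 0)"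
    by (auto simp: power_mult_distrib)
  also have "pi^2 / 6 * (1 / (2 * pi * real c' ^ 2)) = pi / 12 * (real (gcd a c) / real c) ^ 2"
  proof -
    have "real (gcd a c) / real c = 1 / real c'"
    proof -
      have "real c' * real (gcd a c) = real c" by (metis of_nat_mult c'(1))
      thus ?thesis using c'(2) c by (simp add: divide_simps mult.commute)
    qed
    thus ?thesis using c'(2) by (simp add: power2_eq_square)
  qed
  finally have "(\<lambda>n. if c' dvd c' * n then 1 / (2 * pi * real (c' * n) ^ 2) else 0) sums
      (pi / 12 * (real (gcd a c) / real c) ^ 2)" .
  hence "(\<lambda>m. if c' dvd m then 1 / (2 * pi * real m ^ 2) else 0) sums
      (pi / 12 * (real (gcd a c) / real c) ^ 2)"
  proof (subst (asm) sums_mono_reindex)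
    show "strict_mono (\<lambda>n. c' * n)" using c'(2) by (auto simp: strict_mono_def)
  qed (auto simp: dvd_def)
  thus ?thesis by (simp only: dvd)
qed

text \<open>This leading term is a quantitative form of the fact that eta vanishes to order \<open>1/24\<close> at every cusp.
It follows termwise from the Lambert series, without the transformation law of eta.\<close>
lemma ln_norm_eta_at_rational:
  fixes a c :: nat
  assumes c: "c > 0"
  shows "((\<lambda>y. y * ln (norm (dedekind_eta (of_nat a / of_nat c + \<i> * of_real y)))) \<longlongrightarrow>
            - (pi / 12 * (real (gcd a c) / real c) ^ 2)) (at_right 0)"
proof -
  define q where "q = (\<lambda>y::real. exp (2 * of_real pi * \<i> * (of_nat a / of_nat c + \<i> * of_real y)))"
  have nq: "norm (q y) = exp (- (2 * pi * y))" for y unfolding q_def by simp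
  define b :: "nat \<Rightarrow> real" where "b = (\<lambda>m. if c dvd m * a then 1 / (2 * pi * real m ^ 2) else 0)"
  have bs: "b sums (pi / 12 * (real (gcd a c) / real c) ^ 2)"
    unfolding b_def by (rule sums_multiples_inverse_squares[OF c])
  have "((\<lambda>y. \<Sum>m. of_real y * (q y ^ m / (of_nat m * (1 - q y ^ m)))) \<longlongrightarrow>
      (\<Sum>m. complex_of_real (b m))) (at_right 0)"
  proof (rule tannerys_theorem[THEN conjunct2, THEN conjunct2])
    show "((\<lambda>y. of_real y * (q y ^ m / (of_nat m * (1 - q y ^ m)))) \<longlongrightarrow> complex_of_real (b m))
            (at_right 0)" for m
      unfolding q_def b_def by (rule scaled_lambert_term_tendsto[OF c])
    have "\<forall>\<^sub>F y in at_right 0. (0::real) < y" by (rule eventually_at_right_less)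
    hence "\<forall>\<^sub>F x in sequentially \<times>\<^sub>F at_right 0. (0::real) < snd x"
      by (rule eventually_compose_filterlim[OF _ filterlim_snd])
    thus "\<forall>\<^sub>F (m, y) in sequentially \<times>\<^sub>F at_right 0.
        norm (of_real y * (q y ^ m / (of_nat m * (1 - q y ^ m)))) \<le> 1 / (2 * pi * real m ^ 2)"
      by eventually_elim (auto simp only: case_prod_unfold intro!: norm_scaled_lambert_term_le nq)
    have "summable (\<lambda>m. 1 / (2 * pi) * (1 / real m ^ 2))"
      using inverse_power_summable[of 2, where 'a = real]
      by (intro summable_mult) (simp add: inverse_eq_divide)
    thus "summable (\<lambda>m. 1 / (2 * pi * real m ^ 2))" by simp
  qed simp
  moreover have "(\<Sum>m. complex_of_real (b m)) = of_real (pi / 12 * (real (gcd a c) / real c) ^ 2)"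
    using bs by (metis sums_of_real sums_unique)
  ultimately have "((\<lambda>y. \<Sum>m. of_real y * (q y ^ m / (of_nat m * (1 - q y ^ m)))) \<longlongrightarrow>
      of_real (pi / 12 * (real (gcd a c) / real c) ^ 2)) (at_right 0)" by (simp only:)
  from tendsto_Re[OF this]
  have "((\<lambda>y. Re (\<Sum>m. of_real y * (q y ^ m / (of_nat m * (1 - q y ^ m))))) \<longlongrightarrow>
      pi / 12 * (real (gcd a c) / real c) ^ 2) (at_right 0)" by (simp only: Re_complex_of_real)
  hence "((\<lambda>y. y * (- (pi * y / 12)) - Re (\<Sum>m. of_real y * (q y ^ m / (of_nat m * (1 - q y ^ m))))) \<longlongrightarrow>
      0 * (- (pi * 0 / 12)) - pi / 12 * (real (gcd a c) / real c) ^ 2) (at_right 0)"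
    by (intro tendsto_diff) (auto intro!: tendsto_eq_intros)
  hence *: "((\<lambda>y. y * (- (pi * y / 12)) - Re (\<Sum>m. of_real y * (q y ^ m / (of_nat m * (1 - q y ^ m))))) \<longlongrightarrow>
      - (pi / 12 * (real (gcd a c) / real c) ^ 2)) (at_right 0)" by (simp only: mult_zero_left diff_0)
  have "\<forall>\<^sub>F y in at_right 0. y * (- (pi * y / 12)) - Re (\<Sum>m. of_real y * (q y ^ m / (of_nat m * (1 - q y ^ m)))) =
      y * ln (norm (dedekind_eta (of_nat a / of_nat c + \<i> * of_real y)))"
    using eventually_at_right_less[of "0::real"]
  proof eventually_elim
    case (elim y)
    have "norm (q y) < 1" using elim by (simp add: nq)
    hence sum: "(\<Sum>m. of_real y * (q y ^ m / (of_nat m * (1 - q y ^ m)))) = of_real y * lambert (q y)"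
      by (intro sums_unique[symmetric] sums_mult lambert_sums)
    have eta: "ln (norm (dedekind_eta (of_nat a / of_nat c + \<i> * of_real y))) =
        - (pi * y / 12) - Re (lambert (q y))"
      unfolding q_def using elim by (subst ln_norm_dedekind_eta) auto
    show ?case unfolding sum eta by (simp add: right_diff_distrib)
  qed
  thus ?thesis using * by (rule Lim_transform_eventually[rotated])
qed

lemma ln_norm_eta_vertical:
  assumes "y > 0"
  shows "ln (norm (dedekind_eta (of_nat n + \<i> * of_real y))) =
           - (pi * y / 12) - Re (lambert (of_real (exp (- (2 * pi * y)))))"
proof -
  have "exp (2 * of_real pi * \<i> * (of_nat n + \<i> * of_real y)) = complex_of_real (exp (- (2 * pi * y)))"
    using exp_rational_power[of n 1 y 1] exp_integer_2pi[of "of_nat n"]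
    by (simp add: mult_ac)
  thus ?thesis using assms by (subst ln_norm_dedekind_eta) auto
qed

text \<open>On a vertical line \<open>ln \<bar>\<eta>\<bar>\<close> behaves like \<open>- \<pi> / (12 y) + (1 / 2) ln (1 / y)\<close>, where the logarithm
reflects the weight \<open>1/2\<close>.  Doubling \<open>y\<close> and subtracting removes the first term, so that the
weight becomes the leading coefficient.\<close>
lemma ln_norm_eta_duplication:
  fixes s :: real and n :: nat
  assumes s: "s > 0"
  shows "((\<lambda>y. (2 * ln (norm (dedekind_eta (of_nat n + \<i> * of_real (s * (2 * y)))))
               - ln (norm (dedekind_eta (of_nat n + \<i> * of_real (s * y))))) / ln (1 / y))
           \<longlongrightarrow> 1 / 2) (at_right 0)"
proof -
  define q where "q = (\<lambda>y. exp (- (2 * pi * (s * y))))"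
  have bounds: "- ln (1 - q y) / 2 - pi * s * y / 4 \<le>
        2 * ln (norm (dedekind_eta (of_nat n + \<i> * of_real (s * (2 * y)))))
               - ln (norm (dedekind_eta (of_nat n + \<i> * of_real (s * y)))) \<and>
      2 * ln (norm (dedekind_eta (of_nat n + \<i> * of_real (s * (2 * y)))))
               - ln (norm (dedekind_eta (of_nat n + \<i> * of_real (s * y)))) \<le>
        - ln (1 - q y) / 2 + ln (1 + q y) / 2 - pi * s * y / 4" if "y > 0" for y
  proof -
    have q01: "0 < q y" "q y < 1" using that s by (auto simp: q_def)
    have q2: "exp (- (2 * pi * (s * (2 * y)))) = q y ^ 2"
      by (simp add: q_def flip: exp_of_nat_mult)
    have "s * (2 * y) > 0" "s * y > 0" using that s by auto
    note eta = this[THEN ln_norm_eta_vertical[of _ n]]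
    have q1: "exp (- (2 * pi * (s * y))) = q y" by (simp add: q_def)
    show ?thesis
      unfolding eta q2 q1 using lambert_duplication_bounds[OF q01]
      by (auto simp del: of_real_power simp: algebra_simps)
  qed
  show ?thesis
  proof (rule tendsto_sandwich)
    show "((\<lambda>y. (- ln (1 - q y) / 2 - pi * s * y / 4) / ln (1 / y)) \<longlongrightarrow> 1 / 2) (at_right 0)"
      unfolding q_def using s by real_asymp
    show "((\<lambda>y. (- ln (1 - q y) / 2 + ln (1 + q y) / 2 - pi * s * y / 4) / ln (1 / y)) \<longlongrightarrow> 1 / 2) (at_right 0)"
      unfolding q_def using s by real_asymp
    have ln_pos: "\<forall>\<^sub>F y in at_right 0. y > 0 \<and> ln (1 / y) > (0 :: real)"
      by (intro eventually_conj eventually_at_right_less) real_asymp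
    thus "\<forall>\<^sub>F y in at_right 0. (- ln (1 - q y) / 2 - pi * s * y / 4) / ln (1 / y) \<le>
        (2 * ln (norm (dedekind_eta (of_nat n + \<i> * of_real (s * (2 * y)))))
               - ln (norm (dedekind_eta (of_nat n + \<i> * of_real (s * y))))) / ln (1 / y)"
      by eventually_elim (intro divide_right_mono, use bounds in auto)
    show "\<forall>\<^sub>F y in at_right 0.
        (2 * ln (norm (dedekind_eta (of_nat n + \<i> * of_real (s * (2 * y)))))
               - ln (norm (dedekind_eta (of_nat n + \<i> * of_real (s * y))))) / ln (1 / y) \<le>
        (- ln (1 - q y) / 2 + ln (1 + q y) / 2 - pi * s * y / 4) / ln (1 / y)"
      using ln_pos
      by eventually_elim (intro divide_right_mono, use bounds in auto)
  qed
qed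


section \<open>Eta quotients that are modular forms\<close>

lemma ln_norm_eta_quotient:
  assumes N: "N > 0" and z: "Im z > 0"
  shows "ln (norm (eta_quotient N r z)) =
           (\<Sum>\<delta> | \<delta> dvd N. real_of_int (r \<delta>) * ln (norm (dedekind_eta (of_nat \<delta> * z))))"
    and "eta_quotient N r z \<noteq> 0"
proof -
  have nz: "dedekind_eta (of_nat \<delta> * z) \<noteq> 0" if "\<delta> dvd N" for \<delta>
    using that N z by (intro dedekind_eta_nonzero) (auto intro!: mult_pos_pos Nat.gr0I)
  show "eta_quotient N r z \<noteq> 0"
    unfolding eta_quotient_def using nz N by simp
  have "ln (norm (eta_quotient N r z)) =
      ln (\<Prod>\<delta> | \<delta> dvd N. norm (dedekind_eta (of_nat \<delta> * z)) powi r \<delta>)"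
    unfolding eta_quotient_def by (simp add: norm_power_int flip: prod_norm)
  also have "\<dots> = (\<Sum>\<delta> | \<delta> dvd N. ln (norm (dedekind_eta (of_nat \<delta> * z)) powi r \<delta>))"
    using N nz by (intro ln_prod) auto
  also have "\<dots> = (\<Sum>\<delta> | \<delta> dvd N. real_of_int (r \<delta>) * ln (norm (dedekind_eta (of_nat \<delta> * z))))"
    using nz by (intro sum.cong refl ln_power_int) auto
  finally show "ln (norm (eta_quotient N r z)) =
           (\<Sum>\<delta> | \<delta> dvd N. real_of_int (r \<delta>) * ln (norm (dedekind_eta (of_nat \<delta> * z))))" .
qed

text \<open>The matrix with rows \<open>(1, 0)\<close> and \<open>(c, 1)\<close> maps \<open>\<infinity>\<close> to \<open>1 / c\<close>, and it maps the vertical line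
over \<open>-1 / c\<close> to the vertical line over \<open>1 / c\<close>, interchanging large and small imaginary parts.\<close>
lemma modular_form_expansion_at_cusp:
  fixes c :: nat
  assumes f: "f \<in> modular_forms k N" and c: "c > 0"
  obtains h g where "h > (0::nat)" "g holomorphic_on ball 0 1"
    "\<And>y. y > 0 \<Longrightarrow> f (1 / of_nat c + \<i> * of_real y) =
        (\<i> / of_real (real c * y)) powi k * g (exp (2 * of_real pi * \<i> *
             (- 1 / of_nat c + \<i> * of_real (1 / (real c ^ 2 * y))) / of_nat h))"
proof -
  define A :: "int ^ 2 ^ 2" where "A = vector [vector [1, 0], vector [int c, 1]]"
  have "A \<in> SL2Z" by (simp add: SL2Z_def A_def det_2)
  with f have "holomorphic_at_infinity (slash k f A)"
    by (auto simp: modular_forms_def)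
  then obtain h g where hg: "h > (0::nat)" "g holomorphic_on ball 0 1"
    "\<And>z. z \<in> upper_half_plane \<Longrightarrow> slash k f A z = g (exp (2 * of_real pi * \<i> * z / of_nat h))"
    unfolding holomorphic_at_infinity_def by blast
  show thesis
  proof (rule that[OF hg(1,2)])
    fix y :: real assume y: "y > 0"
    define z where "z = - 1 / of_nat c + \<i> * complex_of_real (1 / (real c ^ 2 * y))"
    have "Im z > 0" using y c by (simp add: z_def)
    hence "slash k f A z = g (exp (2 * of_real pi * \<i> * z / of_nat h))"
      by (intro hg(3)) (simp add: upper_half_plane_def)
    moreover have aut: "aut_factor A z = \<i> / of_real (real c * y)"
      using c y by (simp add: aut_factor_def A_def z_def field_simps power2_eq_square)
    moreover have "moebius A z = 1 / of_nat c + \<i> * of_real y"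
      unfolding moebius_def aut using c y
      by (simp add: A_def z_def field_simps power2_eq_square)
    ultimately have "(\<i> / of_real (real c * y)) powi (- k) * f (1 / of_nat c + \<i> * of_real y) =
        g (exp (2 * of_real pi * \<i> * z / of_nat h))"
      by (simp add: slash_def)
    moreover have "\<i> / complex_of_real (real c * y) \<noteq> 0" using c y by simp
    ultimately show "f (1 / of_nat c + \<i> * of_real y) =
        (\<i> / of_real (real c * y)) powi k * g (exp (2 * of_real pi * \<i> *
             (- 1 / of_nat c + \<i> * of_real (1 / (real c ^ 2 * y))) / of_nat h))"
      unfolding z_def[symmetric] by (simp add: power_int_minus field_simps)
  qed
qed

lemma nome_at_cusp_tendsto:
  assumes "c > (0::nat)" "h > (0::nat)"
  shows "((\<lambda>y. exp (2 * of_real pi * \<i> *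
             (- 1 / of_nat c + \<i> * of_real (1 / (real c ^ 2 * y))) / of_nat h)) \<longlongrightarrow> 0) (at_right 0)"
proof (rule tendsto_norm_zero_cancel)
  define c' h' where "c' = real c" and "h' = real h"
  have "c' > 0" "h' > 0" using assms by (auto simp: c'_def h'_def)
  hence "((\<lambda>y. exp (- (2 * pi / (c' ^ 2 * y * h')))) \<longlongrightarrow> 0) (at_right 0)"
    by real_asymp
  thus "((\<lambda>y. norm (exp (2 * of_real pi * \<i> *
             (- 1 / of_nat c + \<i> * of_real (1 / (real c ^ 2 * y))) / of_nat h))) \<longlongrightarrow> 0) (at_right 0)"
    by (simp add: c'_def h'_def field_simps)
qed

text \<open>A positive multiple of the right-hand side is the order of vanishing at the cusp \<open>1 / c\<close>.  If it were
negative, then \<open>ln \<bar>f\<bar>\<close> would grow like \<open>1 / y\<close> on the vertical line over \<open>1 / c\<close>; but \<open>f\<close> is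
bounded there by a constant multiple of \<open>y\<^bsup>-k\<^esup>\<close>.\<close>
lemma eta_quotient_order_at_cusp_nonneg:
  fixes c :: nat
  assumes N: "N > 0" and f: "eta_quotient N r \<in> modular_forms k N" and c: "c > 0"
  shows "0 \<le> (\<Sum>\<delta> | \<delta> dvd N. real (gcd c \<delta>) ^ 2 / real \<delta> * real_of_int (r \<delta>))"
proof -
  let ?f = "\<lambda>y. eta_quotient N r (1 / of_nat c + \<i> * of_real y)"
  from modular_form_expansion_at_cusp[OF f c] obtain h g where h: "h > (0::nat)"
    and g: "g holomorphic_on ball 0 1"
    and fg: "\<And>y. y > 0 \<Longrightarrow> ?f y = (\<i> / of_real (real c * y)) powi k * g (exp (2 * of_real pi * \<i> *
             (- 1 / of_nat c + \<i> * of_real (1 / (real c ^ 2 * y))) / of_nat h))"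
    by blast
  define w where "w = (\<lambda>y. exp (2 * of_real pi * \<i> *
             (- 1 / of_nat c + \<i> * of_real (1 / (real c ^ 2 * y))) / of_nat h))"
  define B where "B = norm (g 0) + 1"
  have "isCont g 0"
    using holomorphic_on_imp_continuous_on[OF g] by (simp add: continuous_on_eq_continuous_at)
  hence "((\<lambda>y. norm (g (w y))) \<longlongrightarrow> norm (g 0)) (at_right 0)"
    unfolding w_def by (intro tendsto_norm isCont_tendsto_compose[OF _ nome_at_cusp_tendsto] c h)
  hence ev: "\<forall>\<^sub>F y in at_right 0. norm (g (w y)) < B"
    by (rule order_tendstoD) (simp add: B_def)
  have lim: "((\<lambda>y. y * ln (norm (?f y))) \<longlongrightarrow>
      (\<Sum>\<delta> | \<delta> dvd N. real_of_int (r \<delta>) *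
         (1 / real \<delta> * (- (pi / 12 * (real (gcd \<delta> c) / real c) ^ 2))))) (at_right 0)"
  proof (rule Lim_transform_eventually)
    show "((\<lambda>y. \<Sum>\<delta> | \<delta> dvd N. real_of_int (r \<delta>) * (1 / real \<delta> *
             ((real \<delta> * y) * ln (norm (dedekind_eta (of_nat \<delta> / of_nat c + \<i> * of_real (real \<delta> * y)))))))
        \<longlongrightarrow> (\<Sum>\<delta> | \<delta> dvd N. real_of_int (r \<delta>) *
         (1 / real \<delta> * (- (pi / 12 * (real (gcd \<delta> c) / real c) ^ 2))))) (at_right 0)"
    proof (intro tendsto_sum tendsto_mult tendsto_const)
      fix \<delta> assume "\<delta> \<in> {\<delta>. \<delta> dvd N}"
      hence "real \<delta> > 0" using N by (auto intro!: Nat.gr0I)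
      hence "filterlim (\<lambda>y. real \<delta> * y) (at_right 0) (at_right 0)"
        by real_asymp
      from filterlim_compose[OF ln_norm_eta_at_rational[OF c, of \<delta>] this]
      show "((\<lambda>y. (real \<delta> * y) * ln (norm (dedekind_eta (of_nat \<delta> / of_nat c + \<i> * of_real (real \<delta> * y)))))
          \<longlongrightarrow> - (pi / 12 * (real (gcd \<delta> c) / real c) ^ 2)) (at_right 0)" .
    qed
    show "\<forall>\<^sub>F y in at_right 0. (\<Sum>\<delta> | \<delta> dvd N. real_of_int (r \<delta>) * (1 / real \<delta> *
             ((real \<delta> * y) * ln (norm (dedekind_eta (of_nat \<delta> / of_nat c + \<i> * of_real (real \<delta> * y))))))) =
        y * ln (norm (?f y))"
      using eventually_at_right_less[of "0::real"]
    proof eventually_elim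
      case (elim y)
      have "ln (norm (?f y)) = (\<Sum>\<delta> | \<delta> dvd N. real_of_int (r \<delta>) *
          ln (norm (dedekind_eta (of_nat \<delta> * (1 / of_nat c + \<i> * of_real y)))))"
        using elim by (intro ln_norm_eta_quotient N) simp
      moreover have "of_nat \<delta> * (1 / of_nat c + \<i> * complex_of_real y) =
          of_nat \<delta> / of_nat c + \<i> * of_real (real \<delta> * y)" for \<delta>
        by (simp add: algebra_simps)
      ultimately have "y * ln (norm (?f y)) = y * (\<Sum>\<delta> | \<delta> dvd N. real_of_int (r \<delta>) *
          ln (norm (dedekind_eta (of_nat \<delta> / of_nat c + \<i> * of_real (real \<delta> * y)))))"
        by (simp only:)
      also have "\<dots> = (\<Sum>\<delta> | \<delta> dvd N. real_of_int (r \<delta>) * (1 / real \<delta> *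
             ((real \<delta> * y) * ln (norm (dedekind_eta (of_nat \<delta> / of_nat c + \<i> * of_real (real \<delta> * y)))))))"
        unfolding sum_distrib_left using N by (intro sum.cong refl) (auto simp: mult_ac)
      finally show ?case by (rule sym)
    qed
  qed
  have upper: "((\<lambda>y. y * (k * ln (1 / (real c * y)) + ln B)) \<longlongrightarrow> 0) (at_right 0)"
  proof -
    define c' where "c' = real c"
    have "c' > 0" using c by (simp add: c'_def)
    hence "((\<lambda>y. y * ln (1 / (c' * y))) \<longlongrightarrow> 0) (at_right 0)" by real_asymp
    hence "((\<lambda>y. k * (y * ln (1 / (c' * y))) + y * ln B) \<longlongrightarrow> real_of_int k * 0 + 0 * ln B) (at_right 0)"
      by (intro tendsto_intros)
    thus ?thesis by (simp add: c'_def algebra_simps)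
  qed
  have "\<forall>\<^sub>F y in at_right 0. y * ln (norm (?f y)) \<le> y * (k * ln (1 / (real c * y)) + ln B)"
    using ev eventually_at_right_less[of "0::real"]
  proof eventually_elim
    case (elim y)
    have "?f y \<noteq> 0" using elim by (intro ln_norm_eta_quotient N) simp
    hence gw: "g (w y) \<noteq> 0" using fg[OF elim(2)] by (auto simp: w_def)
    have "norm (?f y) = (1 / (real c * y)) powi k * norm (g (w y))"
      using elim c by (simp add: fg w_def norm_mult norm_power_int norm_divide)
    hence "ln (norm (?f y)) = k * ln (1 / (real c * y)) + ln (norm (g (w y)))"
      using elim c gw by (simp add: ln_mult ln_power_int)
    also have "\<dots> \<le> k * ln (1 / (real c * y)) + ln B"
      using elim gw by (intro add_left_mono ln_mono) auto
    finally show ?case using elim by (intro mult_left_mono) auto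
  qed
  hence "(\<Sum>\<delta> | \<delta> dvd N. real_of_int (r \<delta>) *
         (1 / real \<delta> * (- (pi / 12 * (real (gcd \<delta> c) / real c) ^ 2)))) \<le> 0"
    by (intro tendsto_le[OF _ upper lim]) simp_all
  also have "(\<Sum>\<delta> | \<delta> dvd N. real_of_int (r \<delta>) *
         (1 / real \<delta> * (- (pi / 12 * (real (gcd \<delta> c) / real c) ^ 2)))) =
      - (pi / (12 * real c ^ 2)) * (\<Sum>\<delta> | \<delta> dvd N. real (gcd c \<delta>) ^ 2 / real \<delta> * real_of_int (r \<delta>))"
    unfolding sum_distrib_left by (intro sum.cong refl) (simp add: power_divide gcd.commute mult_ac)
  finally have "pi / (12 * real c ^ 2) * 0 \<le> pi / (12 * real c ^ 2) *
      (\<Sum>\<delta> | \<delta> dvd N. real (gcd c \<delta>) ^ 2 / real \<delta> * real_of_int (r \<delta>))"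
    by (simp only: mult_minus_left neg_le_0_iff_le mult_zero_right)
  thus ?thesis by (rule mult_left_le_imp_le) (use c in simp)
qed

text \<open>Both sides measure the logarithmic part of \<open>F y = ln \<bar>f(1 + iy)\<bar>\<close> as \<open>y\<close> tends to \<open>0\<close>.  The product of
eta functions contributes \<open>r \<delta> / 2\<close> for each \<open>\<delta>\<close>.  The expansion of \<open>f\<close> at the cusp \<open>1\<close> gives
\<open>k ln (1 / y) - 2\<pi>M / (hy) + O(1)\<close>, where \<open>M\<close> is the order of vanishing of \<open>g\<close> at \<open>0\<close>.  Passing from \<open>F y\<close>
to \<open>2 F (2y) - F y\<close> removes the terms in \<open>1 / y\<close> from both descriptions, so they need
not be compared.\<close>
lemma eta_quotient_weight:
  assumes N: "N > 0" and f: "eta_quotient N r \<in> modular_forms k N"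
  shows "(\<Sum>\<delta> | \<delta> dvd N. real_of_int (r \<delta>)) = 2 * real_of_int k"
proof -
  define F where "F = (\<lambda>y. ln (norm (eta_quotient N r (1 + \<i> * of_real y))))"
  have lim1: "((\<lambda>y. (2 * F (2 * y) - F y) / ln (1 / y)) \<longlongrightarrow>
      (\<Sum>\<delta> | \<delta> dvd N. real_of_int (r \<delta>) * (1 / 2))) (at_right 0)"
  proof (rule Lim_transform_eventually)
    let ?E = "\<lambda>\<delta>::nat. \<lambda>y. ln (norm (dedekind_eta (of_nat \<delta> + \<i> * of_real (real \<delta> * y))))"
    show "((\<lambda>y. \<Sum>\<delta> | \<delta> dvd N. real_of_int (r \<delta>) * ((2 * ?E \<delta> (2 * y) - ?E \<delta> y) / ln (1 / y))) \<longlongrightarrow>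
      (\<Sum>\<delta> | \<delta> dvd N. real_of_int (r \<delta>) * (1 / 2))) (at_right 0)"
      using N by (intro tendsto_sum tendsto_mult tendsto_const ln_norm_eta_duplication)
        (auto intro!: Nat.gr0I)
    have F: "F y = (\<Sum>\<delta> | \<delta> dvd N. real_of_int (r \<delta>) * ?E \<delta> y)" if "y > 0" for y
    proof -
      have "F y = (\<Sum>\<delta> | \<delta> dvd N. real_of_int (r \<delta>) *
          ln (norm (dedekind_eta (of_nat \<delta> * (1 + \<i> * of_real y)))))"
        unfolding F_def using that by (intro ln_norm_eta_quotient N) simp
      thus ?thesis by (simp add: algebra_simps)
    qed
    show "\<forall>\<^sub>F y in at_right 0. (\<Sum>\<delta> | \<delta> dvd N. real_of_int (r \<delta>) *
        ((2 * ?E \<delta> (2 * y) - ?E \<delta> y) / ln (1 / y))) = (2 * F (2 * y) - F y) / ln (1 / y)"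
      using eventually_at_right_less[of "0::real"]
    proof eventually_elim
      case (elim y)
      have pos: "0 < 2 * y" using elim by simp
      show ?case unfolding F[OF elim] F[OF pos] sum_distrib_left sum_subtractf[symmetric] sum_divide_distrib
        by (intro sum.cong refl) (simp add: algebra_simps)
    qed
  qed
  from modular_form_expansion_at_cusp[OF f, of 1] obtain h g where h: "h > (0::nat)"
    and g: "g holomorphic_on ball 0 1"
    and fg: "\<And>y. y > 0 \<Longrightarrow> eta_quotient N r (1 + \<i> * of_real y) =
       (\<i> / of_real y) powi k * g (exp (2 * of_real pi * \<i> * (- 1 + \<i> * of_real (1 / y)) / of_nat h))"
    by (auto simp del: of_real_divide)
  define w where "w = (\<lambda>y. exp (2 * of_real pi * \<i> * (- 1 + \<i> * of_real (1 / y)) / of_nat h))"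
  have fw: "eta_quotient N r (1 + \<i> * of_real y) = (\<i> / of_real y) powi k * g (w y)" if "y > 0" for y
    using fg[OF that] by (simp only: w_def)
  have norm_w: "norm (w y) = exp (- (2 * pi / (y * real h)))" for y
    by (simp add: w_def)
  have w_lim: "(w \<longlongrightarrow> 0) (at_right 0)"
    using nome_at_cusp_tendsto[of 1 h] h by (simp add: w_def[abs_def])
  \<comment> \<open>The nonvanishing of \<open>f\<close> at one point gives \<open>g\<close> a finite order of vanishing at \<open>0\<close>.\<close>
  have "eta_quotient N r (1 + \<i> * of_real 1) \<noteq> 0"
    using N by (intro ln_norm_eta_quotient) auto
  hence "g (w 1) \<noteq> 0" using fg[of 1] by (auto simp: w_def)
  moreover have "w 1 \<in> ball 0 1" using h by (simp add: norm_w)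
  ultimately have "\<exists>x\<in>ball 0 1. g x \<noteq> 0" by blast
  from zorder_exist_zero[OF g open_ball connected_ball
      centre_in_ball[THEN iffD2, OF zero_less_one] this, THEN conjunct2, unfolded diff_zero]
  obtain \<rho> where \<rho>: "\<rho> > 0" "zor_poly g 0 holomorphic_on cball 0 \<rho>"
    "\<And>x. x \<in> cball 0 \<rho> \<Longrightarrow> g x = zor_poly g 0 x * x ^ nat (zorder g 0) \<and> zor_poly g 0 x \<noteq> 0"
    by blast
  define u M where "u = zor_poly g 0" and "M = nat (zorder g 0)"
  have u0: "u 0 \<noteq> 0" using \<rho>(3)[of 0] \<rho>(1) by (simp add: u_def)
  have "isCont u 0"
    using holomorphic_on_imp_continuous_on[OF \<rho>(2)] \<rho>(1) unfolding u_def
    by (intro continuous_on_interior) auto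
  define U where "U = (\<lambda>y. ln (norm (u (w y))))"
  have U_lim: "(U \<longlongrightarrow> ln (norm (u 0))) (at_right 0)"
    unfolding U_def using u0
    by (intro tendsto_ln tendsto_norm isCont_tendsto_compose[OF \<open>isCont u 0\<close> w_lim]) auto
  have double: "filterlim (\<lambda>y::real. 2 * y) (at_right 0) (at_right 0)" by real_asymp
  have U2_lim: "((\<lambda>y. U (2 * y)) \<longlongrightarrow> ln (norm (u 0))) (at_right 0)"
    by (rule filterlim_compose[OF U_lim double])
  have "\<forall>\<^sub>F y in at_right 0. norm (w y) < \<rho>"
    using order_tendstoD(2)[OF tendsto_norm_zero[OF w_lim] \<rho>(1)] .
  hence F: "\<forall>\<^sub>F y in at_right 0. F y = k * ln (1 / y) + U y - M * (2 * pi / (y * real h))"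
    using eventually_at_right_less[of "0::real"]
  proof eventually_elim
    case (elim y)
    have gw: "g (w y) = u (w y) * w y ^ M" "u (w y) \<noteq> 0"
      using \<rho>(3)[of "w y"] elim(1) by (auto simp: u_def M_def)
    have "norm (eta_quotient N r (1 + \<i> * of_real y)) = (1 / y) powi k * (norm (u (w y)) * norm (w y) ^ M)"
      unfolding fw[OF elim(2)] gw(1) using elim
      by (simp add: norm_mult norm_power_int norm_divide norm_power)
    hence "F y = ln ((1 / y) powi k * (norm (u (w y)) * norm (w y) ^ M))"
      by (simp add: F_def)
    also have "\<dots> = k * ln (1 / y) + (U y + M * ln (norm (w y)))"
      using elim gw(2) by (simp add: ln_mult ln_power_int ln_realpow U_def norm_w)
    finally show ?case by (simp add: norm_w)
  qed
  have lim2: "((\<lambda>y. (2 * F (2 * y) - F y) / ln (1 / y)) \<longlongrightarrow>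
      real_of_int k * 1 + (2 * ln (norm (u 0)) - ln (norm (u 0))) * 0) (at_right 0)"
  proof (rule Lim_transform_eventually)
    have "((\<lambda>y::real. (2 * ln (1 / (2 * y)) - ln (1 / y)) / ln (1 / y)) \<longlongrightarrow> 1) (at_right 0)"
      by real_asymp
    moreover have "((\<lambda>y::real. 1 / ln (1 / y)) \<longlongrightarrow> 0) (at_right 0)" by real_asymp
    ultimately show "((\<lambda>y. k * ((2 * ln (1 / (2 * y)) - ln (1 / y)) / ln (1 / y))
          + (2 * U (2 * y) - U y) * (1 / ln (1 / y))) \<longlongrightarrow>
      real_of_int k * 1 + (2 * ln (norm (u 0)) - ln (norm (u 0))) * 0) (at_right 0)"
      by (intro tendsto_intros U_lim U2_lim)
    show "\<forall>\<^sub>F y in at_right 0. k * ((2 * ln (1 / (2 * y)) - ln (1 / y)) / ln (1 / y))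
          + (2 * U (2 * y) - U y) * (1 / ln (1 / y)) = (2 * F (2 * y) - F y) / ln (1 / y)"
      using F eventually_compose_filterlim[OF F double]
    proof eventually_elim
      case (elim y)
      have "2 * F (2 * y) - F y = k * (2 * ln (1 / (2 * y)) - ln (1 / y)) + (2 * U (2 * y) - U y)"
        unfolding elim by (simp add: algebra_simps)
      thus ?case by (simp add: add_divide_distrib)
    qed
  qed
  have "(\<Sum>\<delta> | \<delta> dvd N. real_of_int (r \<delta>) * (1 / 2)) = k"
    using tendsto_unique[OF _ lim1 lim2] by simp
  thus ?thesis by (simp flip: sum_distrib_right sum_divide_distrib)
qed

theorem theorem2:
  fixes N :: nat and k :: int and r :: "nat \<Rightarrow> int"
  assumes "N > 0"
    and "eta_quotient N r \<in> modular_forms k N"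
  shows "(\<Sum>\<delta> | \<delta> dvd N. \<bar>real_of_int (r \<delta>)\<bar>)
           \<le> 2 * real_of_int k *
             (\<Prod>p | prime p \<and> p dvd N.
                ((real p + 1) / (real p - 1)) ^ min 2 (multiplicity p N))"
proof -
  have "(\<Sum>\<delta> | \<delta> dvd N. \<bar>real_of_int (r \<delta>)\<bar>) \<le>
      (\<Prod>p | prime p \<and> p dvd N. ((real p + 1) / (real p - 1)) ^ min 2 (multiplicity p N))
        * (\<Sum>\<delta> | \<delta> dvd N. real_of_int (r \<delta>))"
  proof (rule l1_norm_le_of_gcd_sums_nonneg[OF assms(1)])
    fix c assume "c dvd N"
    hence "c > 0" using assms(1) by (auto intro!: Nat.gr0I)
    thus "0 \<le> (\<Sum>\<delta> | \<delta> dvd N. real (gcd c \<delta>) ^ 2 / real \<delta> * real_of_int (r \<delta>))"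
      by (rule eta_quotient_order_at_cusp_nonneg[OF assms])
  qed
  thus ?thesis unfolding eta_quotient_weight[OF assms] by (simp only: mult.commute)
qed

end
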